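(* For any integers $r,s\ge 0$ and complex numbers $a,b$, $$\sum_{i=0}^{r-1}\tau(i)a^i\,\theta(q,bq^i)+\sum_{i=0}^{s-1}\tau(i)b^i\,\theta(q,aq^i)-\sum_{i=0}^{r-1}\sum_{j=0}^{s-1}\tau(i+j)a^ib^j=L(a,b)-a^rb^s\,\tau(r+s)\,L(aq^{r+s},bq^{r+s}),$$ where $$L(x,y)=(q,x,y;q)_\infty\sum_{n=0}^\infty\frac{(xy/q^2;q)_{2n}}{(q,x,y,xy/q^2;q)_n}\,q^n .$$
   Context: Here $q$ is a fixed complex number with $0<|q|<1$, and parameters are assumed to be such that no denominator vanishes. Notation: $(x;q)_\infty=\prod_{n\ge0}(1-xq^n)$, $(x;q)_n=(x;q)_\infty/(xq^n;q)_\infty$, and $(a_1,\ldots,a_m;q)_n=(a_1;q)_n\cdots(a_m;q)_n$ for $n$ an integer or $\infty$. The partial theta function is $\theta(q,x)=\sum_{n=0}^\infty\tau(n)x^n$ with $\tau(n)=(-1)^nq^{n(n-1)/2}$. An empty sum $\sum_{i=0}^{-1}$ equals $0$. *)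

theory Defs
  imports "HOL-Analysis.Analysis"
begin

definition qpoch_inf :: "complex \<Rightarrow> complex \<Rightarrow> complex" where
  "qpoch_inf q x = (\<Prod>n. 1 - x * q ^ n)"

text \<open>Meaningful only if the infinite product in the denominator does not vanish.\<close>

definition qpoch :: "complex \<Rightarrow> complex \<Rightarrow> int \<Rightarrow> complex" where
  "qpoch q x n = qpoch_inf q x / qpoch_inf q (x * q powi n)"

definition qpochs_inf :: "complex \<Rightarrow> complex list \<Rightarrow> complex" where
  "qpochs_inf q xs = (\<Prod>x\<leftarrow>xs. qpoch_inf q x)"

definition qpochs :: "complex \<Rightarrow> complex list \<Rightarrow> int \<Rightarrow> complex" where
  "qpochs q xs n = (\<Prod>x\<leftarrow>xs. qpoch q x n)"

definition qtau :: "complex \<Rightarrow> nat \<Rightarrow> complex" where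
  "qtau q n = (- 1) ^ n * q ^ (n * (n - 1) div 2)"

definition partial_theta :: "complex \<Rightarrow> complex \<Rightarrow> complex" where
  "partial_theta q x = (\<Sum>n. qtau q n * x ^ n)"

definition L_series :: "complex \<Rightarrow> complex \<Rightarrow> complex \<Rightarrow> complex" where
  "L_series q x y =
     qpochs_inf q [q, x, y] *
     (\<Sum>n. qpoch q (x * y / q ^ 2) (2 * int n) / qpochs q [q, x, y, x * y / q ^ 2] (int n) * q ^ n)"

end

theory Submission
  imports Defs
begin

text \<open>
  Put \<open>c = x y / q\<^sup>2\<close>. After cancelling the finite products against the infinite ones,
  \<open>L(x, y)\<close> is the sum over \<open>n\<close> of
  \<open>q\<^sup>n (q\<^sup>n\<^sup>+\<^sup>1, x q\<^sup>n, y q\<^sup>n, c q\<^sup>n; q)\<^sub>\<infinity> / (c q\<^sup>2\<^sup>n; q)\<^sub>\<infinity>\<close>. The theorem amounts to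
  \<open>L(x, y)\<close> being the double series \<open>\<Sum>\<^sub>i\<^sub>,\<^sub>j \<tau>(i + j) x\<^sup>i y\<^sup>j\<close>: since
  \<open>\<tau>(i + j) = \<tau>(i) \<tau>(j) q\<^sup>i\<^sup>j\<close>, the left-hand side collects the pairs with \<open>i < r\<close> or
  \<open>j < s\<close>, and the pairs with \<open>i \<ge> r\<close> and \<open>j \<ge> s\<close> form the multiple of
  \<open>L(a q\<^sup>r\<^sup>+\<^sup>s, b q\<^sup>r\<^sup>+\<^sup>s)\<close> on the right.

  The proof replaces the double series by the relation that sums it in one direction,
  \<open>L(x, y) + x L(x q, y q) = \<theta>(q, y)\<close>, and its mirror image; the theorem follows from
  these two by induction on \<open>s\<close> and then on \<open>r\<close>, where each step adds one row or one column.

  The generating function \<open>\<Sum>\<^sub>m \<tau>(m) h\<^sub>m(x, y)\<close> of the complete homogeneous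
  polynomials, \<open>h\<^sub>m = (x + y) h\<^sub>m\<^sub>-\<^sub>1 - x y h\<^sub>m\<^sub>-\<^sub>2\<close>, suggests the relation
  \<open>L(x, y) + (x + y) L(x q, y q) + x y q L(x q\<^sup>2, y q\<^sup>2) = 1\<close>. It involves no theta
  function, and it holds termwise up to a telescoping difference with an explicit
  antidifference (\<open>L_term_telescope\<close>). Its operator factors: with
  \<open>\<phi>(x, y) = L(x, y) + x L(x q, y q)\<close> it says \<open>\<phi>(x, y) + y \<phi>(x q, y q) = 1\<close>, and
  iterating this produces \<open>\<phi>(x, y) = \<theta>(q, y)\<close>, because \<open>L\<close> stays bounded along
  the orbit \<open>(x q\<^sup>N, y q\<^sup>N)\<close>.
\<close>

section \<open>Infinite q-Pochhammer symbols along geometric sequences\<close>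

lemma convergent_qpoch_factors:
  fixes q x :: complex
  assumes "norm q < 1" and "\<And>k::nat. x * q ^ k \<noteq> 1"
  shows "convergent_prod (\<lambda>n. 1 - x * q ^ n)"
proof -
  have "summable (\<lambda>n. norm (- x * q ^ n))"
    using assms by (simp add: norm_mult norm_power summable_mult summable_geometric)
  from summable_imp_convergent_prod_complex[OF this] show ?thesis
    using assms(2) by simp
qed

lemma qpoch_inf_nonzero:
  assumes "norm q < 1" and "\<And>k::nat. x * q ^ k \<noteq> 1"
  shows "qpoch_inf q x \<noteq> 0"
  unfolding qpoch_inf_def
  by (rule prodinf_nonzero[OF convergent_qpoch_factors[OF assms]]) (use assms in auto)

lemma nonvanishing_shift:
  fixes q x :: complex
  assumes "\<And>k::nat. x * q ^ k \<noteq> 1"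
  shows "x * q ^ n * q ^ k \<noteq> 1"
  using assms[of "n + k"] by (simp add: power_add mult.assoc)

lemma qpoch_inf_step:
  assumes "norm q < 1" and "\<And>k::nat. x * q ^ k \<noteq> 1"
  shows "qpoch_inf q (x * q ^ n) = (1 - x * q ^ n) * qpoch_inf q (x * q ^ Suc n)"
proof -
  have nv: "x * q ^ n * q ^ k \<noteq> 1" for k by (rule nonvanishing_shift) (rule assms(2))
  show ?thesis
    using prodinf_split_head[OF convergent_qpoch_factors[OF assms(1) nv]] nv[of 0]
    by (simp add: qpoch_inf_def mult_ac)
qed

lemma qpoch_inf_shift_tendsto:
  assumes "norm q < 1" and nz: "\<And>k::nat. x * q ^ k \<noteq> 1" and "strict_mono f"
  shows "(\<lambda>n. qpoch_inf q (x * q ^ f n)) \<longlonglongrightarrow> 1"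
proof -
  define pp where "pp n = (\<Prod>k\<le>n. 1 - x * q ^ k)" for n
  have split: "pp n * qpoch_inf q (x * q ^ Suc n) = qpoch_inf q x" for n
  proof (induction n)
    case 0
    show ?case using qpoch_inf_step[OF assms(1) nz, of 0] by (simp add: pp_def)
  next
    case (Suc n)
    with qpoch_inf_step[OF assms(1) nz, of "Suc n"] show ?case by (simp add: pp_def mult_ac)
  qed
  have nzP: "qpoch_inf q x \<noteq> 0" using assms(1,2) by (rule qpoch_inf_nonzero)
  have "pp n \<noteq> 0" for n using split[of n] nzP by auto
  hence eq: "qpoch_inf q (x * q ^ Suc n) = qpoch_inf q x / pp n" for n
    using split[of n] by (simp add: field_simps)
  have "pp \<longlonglongrightarrow> qpoch_inf q x"
    using convergent_prod_LIMSEQ[OF convergent_qpoch_factors[OF assms(1,2)]]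
    unfolding pp_def qpoch_inf_def by simp
  hence "(\<lambda>n. qpoch_inf q x / pp n) \<longlonglongrightarrow> qpoch_inf q x / qpoch_inf q x"
    using nzP by (intro tendsto_intros)
  hence "(\<lambda>n. qpoch_inf q (x * q ^ Suc n)) \<longlonglongrightarrow> 1" using nzP eq by simp
  hence "(\<lambda>n. qpoch_inf q (x * q ^ n)) \<longlonglongrightarrow> 1" by (rule LIMSEQ_imp_Suc)
  from filterlim_compose[OF this filterlim_subseq[OF assms(3)]] show ?thesis .
qed

lemma qpoch_inf_shift_bounded:
  assumes "norm q < 1" and "\<And>k::nat. x * q ^ k \<noteq> 1"
  obtains K where "K > 0" and "\<And>n. norm (qpoch_inf q (x * q ^ n)) \<le> K"
    and "\<And>n. norm (inverse (qpoch_inf q (x * q ^ n))) \<le> K"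
proof -
  have lim: "(\<lambda>n. qpoch_inf q (x * q ^ n)) \<longlonglongrightarrow> 1"
    using qpoch_inf_shift_tendsto[OF assms, of id] by (simp add: strict_mono_def)
  have "(\<lambda>n. inverse (qpoch_inf q (x * q ^ n))) \<longlonglongrightarrow> inverse 1"
    by (intro tendsto_inverse lim) auto
  with lim have "Bseq (\<lambda>n. qpoch_inf q (x * q ^ n))" "Bseq (\<lambda>n. inverse (qpoch_inf q (x * q ^ n)))"
    by (auto intro!: convergent_imp_Bseq convergentI)
  then obtain K1 K2 where "K1 > 0" "\<And>n. norm (qpoch_inf q (x * q ^ n)) \<le> K1"
    "\<And>n. norm (inverse (qpoch_inf q (x * q ^ n))) \<le> K2"
    unfolding Bseq_def by blast
  thus thesis by (intro that[of "max K1 K2"]) (auto simp: le_max_iff_disj)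
qed

section \<open>The partial theta function\<close>

lemma qtau_0 [simp]: "qtau q 0 = 1"
  by (simp add: qtau_def)

lemma qtau_Suc: "qtau q (Suc n) = - (q ^ n) * qtau q n"
proof -
  have "Suc n * n div 2 = n + n * (n - 1) div 2"
    by (cases n) (auto simp: algebra_simps)
  thus ?thesis by (simp add: qtau_def power_add)
qed

lemma qtau_add: "qtau q (i + j) = qtau q i * qtau q j * q ^ (i * j)"
  by (induction j) (auto simp: qtau_Suc power_add)

lemma summable_partial_theta:
  assumes "norm q < 1"
  shows "summable (\<lambda>n. qtau q n * z ^ n)"
proof -
  have "(\<lambda>n. q ^ n * z) \<longlonglongrightarrow> 0 * z"
    using assms by (intro tendsto_intros LIMSEQ_power_zero)
  hence "(\<lambda>n. norm (q ^ n * z)) \<longlonglongrightarrow> 0" by (simp add: tendsto_norm_zero)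
  hence "eventually (\<lambda>n. norm (q ^ n * z) < 1/2) sequentially"
    by (rule order_tendstoD) simp
  then obtain N where N: "\<And>n. n \<ge> N \<Longrightarrow> norm (q ^ n * z) < 1/2"
    by (auto simp: eventually_sequentially)
  show ?thesis
  proof (rule summable_ratio_test)
    fix n assume "N \<le> n"
    have "norm (qtau q (Suc n) * z ^ Suc n) = norm (q ^ n * z) * norm (qtau q n * z ^ n)"
      by (simp add: qtau_Suc norm_mult)
    also have "\<dots> \<le> 1/2 * norm (qtau q n * z ^ n)"
      using N[OF \<open>N \<le> n\<close>] by (intro mult_right_mono) auto
    finally show "norm (qtau q (Suc n) * z ^ Suc n) \<le> 1/2 * norm (qtau q n * z ^ n)" .
  qed simp
qed

lemma partial_theta_split:
  assumes "norm q < 1"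
  shows "partial_theta q z
    = (\<Sum>j<s. qtau q j * z ^ j) + qtau q s * z ^ s * partial_theta q (z * q ^ s)"
proof -
  have "partial_theta q z = (\<Sum>n. qtau q (n + s) * z ^ (n + s)) + (\<Sum>j<s. qtau q j * z ^ j)"
    unfolding partial_theta_def
    by (rule suminf_split_initial_segment[OF summable_partial_theta[OF assms]])
  also have "(\<lambda>n. qtau q (n + s) * z ^ (n + s))
      = (\<lambda>n. qtau q s * z ^ s * (qtau q n * (z * q ^ s) ^ n))"
    by (simp add: qtau_add power_add power_mult_distrib power_mult[symmetric] mult_ac)
  also have "(\<Sum>n. qtau q s * z ^ s * (qtau q n * (z * q ^ s) ^ n))
      = qtau q s * z ^ s * partial_theta q (z * q ^ s)"
    unfolding partial_theta_def by (rule suminf_mult[OF summable_partial_theta[OF assms]])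
  finally show ?thesis by simp
qed

text \<open>
  Iterating the recursion \<open>n\<close> times expands \<open>\<phi> 0\<close> as a partial sum of the theta series plus
  \<open>\<tau>(n) y\<^sup>n \<phi> n\<close>. Boundedness makes the remainder vanish, so that \<open>\<theta>\<close> gives the only bounded
  solution.
\<close>

lemma bounded_solution_eq_partial_theta:
  assumes q: "norm q < 1"
    and rec: "\<And>n. \<phi> n + y * q ^ n * \<phi> (Suc n) = 1"
    and bound: "\<And>n. norm (\<phi> n) \<le> B"
  shows "\<phi> 0 = partial_theta q y"
proof -
  have expand: "\<phi> 0 = (\<Sum>i<n. qtau q i * y ^ i) + qtau q n * y ^ n * \<phi> n" for n
  proof (induction n)
    case (Suc n)
    have "\<phi> n = 1 - y * q ^ n * \<phi> (Suc n)" using rec[of n] by (simp add: algebra_simps)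
    with Suc show ?case by (simp add: qtau_Suc algebra_simps)
  qed simp
  have "(\<lambda>n. qtau q n * y ^ n) \<longlonglongrightarrow> 0"
    using summable_partial_theta[OF q] by (rule summable_LIMSEQ_zero)
  moreover have "Bseq \<phi>" using bound by (rule BseqI')
  ultimately have "(\<lambda>n. qtau q n * y ^ n * \<phi> n) \<longlonglongrightarrow> 0"
    using bounded_bilinear.Zfun_prod_Bfun[OF bounded_bilinear_mult]
    by (fastforce simp: tendsto_Zfun_iff)
  hence "(\<lambda>n. \<phi> 0 - qtau q n * y ^ n * \<phi> n) \<longlonglongrightarrow> \<phi> 0 - 0" by (intro tendsto_intros)
  moreover have "(\<lambda>n. \<phi> 0 - qtau q n * y ^ n * \<phi> n) = (\<lambda>n. \<Sum>i<n. qtau q i * y ^ i)"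
    using expand by (auto simp: algebra_simps)
  ultimately have "(\<lambda>i. qtau q i * y ^ i) sums \<phi> 0" by (simp add: sums_def)
  thus ?thesis by (simp add: partial_theta_def sums_iff)
qed

section \<open>The telescoping recursion\<close>

text \<open>
  The third parameter stands for \<open>x y / q\<^sup>2\<close>. The factor \<open>(c q\<^sup>n)\<^sub>\<infinity> / (c q\<^sup>2\<^sup>n)\<^sub>\<infinity>\<close> is what
  remains of \<open>(c)\<^sub>2\<^sub>n / (c)\<^sub>n\<close>.
\<close>

definition L_term :: "complex \<Rightarrow> complex \<Rightarrow> complex \<Rightarrow> complex \<Rightarrow> nat \<Rightarrow> complex" where
  "L_term q x y c n = q ^ n * qpoch_inf q (q * q ^ n) * qpoch_inf q (x * q ^ n) *
     qpoch_inf q (y * q ^ n) * qpoch_inf q (c * q ^ n) / qpoch_inf q (c * q ^ (2 * n))"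

text \<open>
  The antidifference of Gosper's algorithm for the sum of the three terms of the recursion.
  The factor \<open>(1 - q\<^sup>n) (q\<^sup>n\<^sup>+\<^sup>1)\<^sub>\<infinity>\<close> is \<open>(q\<^sup>n)\<^sub>\<infinity>\<close> and vanishes at \<open>n = 0\<close>.
\<close>

definition L_antidiff :: "complex \<Rightarrow> complex \<Rightarrow> complex \<Rightarrow> complex \<Rightarrow> nat \<Rightarrow> complex" where
  "L_antidiff q x y c n = (1 - q ^ n) * qpoch_inf q (q * q ^ n) *
     (qpoch_inf q (x * q ^ n) * qpoch_inf q (y * q ^ n) * qpoch_inf q (c * q ^ (n + 2))
        * (1 - q * c ^ 2 * q ^ (3 * n)) / qpoch_inf q (c * q ^ (2 * n))
      + c * q ^ (n + 2) * qpoch_inf q (x * q ^ (n + 1)) * qpoch_inf q (y * q ^ (n + 1))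
        * qpoch_inf q (c * q ^ (n + 3)) / qpoch_inf q (c * q ^ (2 * n + 2)))"

text \<open>
  The rational identity behind the telescoping, with \<open>Q = q\<^sup>n\<close> and with the common infinite
  products removed. Writing \<open>x = q X\<close>, \<open>y = q Y\<close>, \<open>c = X Y\<close> solves \<open>x y = q\<^sup>2 c\<close>
  without denominators.
\<close>

lemma antidiff_polynomial_identity:
  fixes q X Y Q :: complex
  defines "x \<equiv> q * X" and "y \<equiv> q * Y" and "c \<equiv> X * Y"
  defines "W \<equiv> \<lambda>Q. (1 - x*Q) * (1 - y*Q) * (1 - c*q^2*Q) * (1 - q*c^2*Q^3)
      + c*q^2*Q * (1 - c*Q^2) * (1 - c*q*Q^2)"
  shows "(1 - c*Q^2) * (1 - c*q*Q^2) * W (q*Q)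
      - (1 - Q) * (1 - x*q*Q) * (1 - y*q*Q) * (1 - c*q^3*Q) * W Q
    = Q * ((1 - x*Q) * (1 - x*q*Q) * (1 - y*Q) * (1 - y*q*Q)
             * (1 - c*Q) * (1 - c*q*Q) * (1 - c*q^2*Q) * (1 - c*q^3*Q)
         + (x + y) * (1 - x*q*Q) * (1 - y*q*Q) * (1 - c*q^2*Q) * (1 - c*q^3*Q)
             * (1 - c*Q^2) * (1 - c*q*Q^2)
         + x*y*q * (1 - c*Q^2) * (1 - c*q*Q^2) * (1 - c*q^2*Q^2) * (1 - c*q^3*Q^2))"
  unfolding x_def y_def c_def W_def by algebra

text \<open>
  Any parameters satisfying these hypotheses can be replaced by \<open>(x q\<^sup>N, y q\<^sup>N, c q\<^sup>2\<^sup>N)\<close>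
  or by \<open>(y, x, c)\<close>. Hence every statement about \<open>L 0\<close> below holds at each point of the
  orbit, and every statement about rows has a counterpart about columns.
\<close>

locale L_parameters =
  fixes q x y c :: complex
  assumes q0: "q \<noteq> 0" and q1: "norm q < 1" and xyc: "x * y = q ^ 2 * c"
    and x_nv: "\<And>k::nat. x * q ^ k \<noteq> 1"
    and y_nv: "\<And>k::nat. y * q ^ k \<noteq> 1"
    and c_nv: "\<And>k::nat. c * q ^ k \<noteq> 1"
begin

lemma q_nv: "q * q ^ k \<noteq> 1" for k :: nat
proof
  assume "q * q ^ k = 1"
  hence "norm (q * q ^ k) = 1" by simp
  moreover have "norm q ^ Suc k < 1"
    using q0 q1 by (intro power_Suc_less_one) auto
  ultimately show False by (simp add: norm_mult norm_power)
qed

lemma shifted: "L_parameters q (x * q ^ N) (y * q ^ N) (c * q ^ (2 * N))"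
proof
  show "x * q ^ N * (y * q ^ N) = q\<^sup>2 * (c * q ^ (2 * N))"
  proof -
    have "x * q ^ N * (y * q ^ N) = x * y * q ^ (2 * N)"
      by (simp add: mult_2_right power_add mult_ac)
    thus ?thesis by (simp add: xyc mult.assoc)
  qed
qed (use q0 q1 nonvanishing_shift[OF x_nv] nonvanishing_shift[OF y_nv] nonvanishing_shift[OF c_nv]
      in \<open>auto\<close>)

lemma swapped: "L_parameters q y x c"
  by standard (use q0 q1 xyc x_nv y_nv c_nv in \<open>auto simp: mult_ac\<close>)

definition "L N = (\<Sum>n. L_term q (x * q ^ N) (y * q ^ N) (c * q ^ (2 * N)) n)"

text \<open>
  One geometric majorant serves for all \<open>N\<close>, because all arguments of the infinite products
  lie on four fixed geometric sequences, along which these products and, for \<open>c\<close>, their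
  inverses are bounded.
\<close>

lemma L_term_bound:
  obtains K where
    "\<And>N n. norm (L_term q (x * q ^ N) (y * q ^ N) (c * q ^ (2 * N)) n) \<le> K * norm q ^ n"
proof -
  obtain A where A: "A > 0" "\<And>n. norm (qpoch_inf q (q * q ^ n)) \<le> A"
    using qpoch_inf_shift_bounded[OF q1 q_nv] by metis
  obtain X where X: "X > 0" "\<And>n. norm (qpoch_inf q (x * q ^ n)) \<le> X"
    using qpoch_inf_shift_bounded[OF q1 x_nv] by metis
  obtain Y where Y: "Y > 0" "\<And>n. norm (qpoch_inf q (y * q ^ n)) \<le> Y"
    using qpoch_inf_shift_bounded[OF q1 y_nv] by metis
  obtain C where C: "C > 0" "\<And>n. norm (qpoch_inf q (c * q ^ n)) \<le> C"
    "\<And>n. norm (inverse (qpoch_inf q (c * q ^ n))) \<le> C"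
    using qpoch_inf_shift_bounded[OF q1 c_nv] by metis
  have "norm (L_term q (x * q ^ N) (y * q ^ N) (c * q ^ (2 * N)) n)
      \<le> norm q ^ n * A * X * Y * C * C" for N n
  proof -
    have "norm (L_term q (x * q ^ N) (y * q ^ N) (c * q ^ (2 * N)) n)
      = norm q ^ n * norm (qpoch_inf q (q * q ^ n)) * norm (qpoch_inf q (x * q ^ (N + n)))
        * norm (qpoch_inf q (y * q ^ (N + n))) * norm (qpoch_inf q (c * q ^ (2 * N + n)))
        * norm (inverse (qpoch_inf q (c * q ^ (2 * N + 2 * n))))"
      by (simp add: L_term_def norm_mult norm_power norm_divide divide_inverse norm_inverse
          power_add mult.assoc)
    also have "\<dots> \<le> norm q ^ n * A * X * Y * C * C"
      using A X Y C by (intro mult_mono mult_nonneg_nonneg) (auto intro: less_imp_le)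
    finally show ?thesis .
  qed
  thus thesis by (intro that[of "A * X * Y * C * C"]) (auto simp: mult_ac)
qed

lemma L_sums: "L_term q (x * q ^ N) (y * q ^ N) (c * q ^ (2 * N)) sums L N"
proof -
  obtain K where
    "\<And>N n. norm (L_term q (x * q ^ N) (y * q ^ N) (c * q ^ (2 * N)) n) \<le> K * norm q ^ n"
    using L_term_bound by blast
  moreover have "summable (\<lambda>n. K * norm q ^ n)"
    using q1 by (intro summable_mult summable_geometric) simp
  ultimately have "summable (L_term q (x * q ^ N) (y * q ^ N) (c * q ^ (2 * N)))"
    by (rule summable_comparison_test'[rotated])
  thus ?thesis by (simp add: L_def summable_sums)
qed

lemma L_bounded:
  obtains B where "\<And>N. norm (L N) \<le> B"
proof -
  obtain K where
    K: "\<And>N n. norm (L_term q (x * q ^ N) (y * q ^ N) (c * q ^ (2 * N)) n) \<le> K * norm q ^ n"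
    using L_term_bound by blast
  have "summable (\<lambda>n. K * norm q ^ n)"
    using q1 by (intro summable_mult summable_geometric) simp
  hence "norm (L N) \<le> (\<Sum>n. K * norm q ^ n)" for N
    unfolding L_def using K by (rule norm_suminf_le[rotated])
  thus thesis by (rule that)
qed

lemma L_term_telescope:
  "L_term q x y c n + (x + y) * L_term q (x * q) (y * q) (c * q ^ 2) n
     + x * y * q * L_term q (x * q ^ 2) (y * q ^ 2) (c * q ^ 4) n
   = L_antidiff q x y c (Suc n) - L_antidiff q x y c n"
proof -
  define Q where "Q = q ^ n"
  define A where "A = qpoch_inf q (q * q ^ n)"
  define X where "X i = qpoch_inf q (x * q ^ (n + i))" for i
  define Y where "Y i = qpoch_inf q (y * q ^ (n + i))" for i
  define C where "C i = qpoch_inf q (c * q ^ (n + i))" for i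
  define G where "G i = qpoch_inf q (c * q ^ (2 * n + i))" for i
  have A: "A = (1 - q * Q) * qpoch_inf q (q * q ^ Suc n)"
    using qpoch_inf_step[OF q1 q_nv, of n] by (simp add: A_def Q_def)
  have X: "X i = (1 - x * q ^ i * Q) * X (Suc i)" for i
    using qpoch_inf_step[OF q1 x_nv, of "n + i"] by (simp add: X_def Q_def power_add mult_ac)
  have Y: "Y i = (1 - y * q ^ i * Q) * Y (Suc i)" for i
    using qpoch_inf_step[OF q1 y_nv, of "n + i"] by (simp add: Y_def Q_def power_add mult_ac)
  have C: "C i = (1 - c * q ^ i * Q) * C (Suc i)" for i
    using qpoch_inf_step[OF q1 c_nv, of "n + i"] by (simp add: C_def Q_def power_add mult_ac)
  have G: "G i = (1 - c * q ^ i * Q ^ 2) * G (Suc i)" for i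
    using qpoch_inf_step[OF q1 c_nv, of "2 * n + i"]
    by (simp add: G_def Q_def power_add power_mult power2_eq_square mult_ac power_mult_distrib)
  have G_nz: "G i \<noteq> 0" for i
    unfolding G_def using q1 nonvanishing_shift[OF c_nv] by (rule qpoch_inf_nonzero)
  (* All five quantities are polynomial multiples of one common factor. *)
  define K where "K = A * X 2 * Y 2 * C 4 / G 0"
  define g where "g i = 1 - c * q ^ i * Q ^ 2" for i
  have X': "X 1 = (1 - x*q*Q) * X 2" "X 0 = (1 - x*Q) * (1 - x*q*Q) * X 2"
    using X[of 0] X[of 1] by (simp_all add: numeral_2_eq_2)
  have Y': "Y 1 = (1 - y*q*Q) * Y 2" "Y 0 = (1 - y*Q) * (1 - y*q*Q) * Y 2"
    using Y[of 0] Y[of 1] by (simp_all add: numeral_2_eq_2)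
  have C': "C 3 = (1 - c*q^3*Q) * C 4" "C 2 = (1 - c*q^2*Q) * (1 - c*q^3*Q) * C 4"
    "C 0 = (1 - c*Q) * (1 - c*q*Q) * (1 - c*q^2*Q) * (1 - c*q^3*Q) * C 4"
    using C[of 0] C[of 1] C[of 2] C[of 3] by (simp_all add: eval_nat_numeral)
  have "G 0 = g 0 * g 1 * G 2" "G 2 = g 2 * g 3 * G 4"
    using G[of 0] G[of 1] G[of 2] G[of 3] by (simp_all add: eval_nat_numeral g_def)
  hence G': "inverse (G 2) = g 0 * g 1 * inverse (G 0)"
    "inverse (G 4) = g 0 * g 1 * g 2 * g 3 * inverse (G 0)"
    using G_nz[of 0] G_nz[of 2] G_nz[of 4] by (auto simp: field_simps)
  define W where "W \<equiv> \<lambda>Q. (1 - x*Q) * (1 - y*Q) * (1 - c*q^2*Q) * (1 - q*c^2*Q^3)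
      + c*q^2*Q * (1 - c*Q^2) * (1 - c*q*Q^2)"
  have g': "g 0 = 1 - c*Q^2" "g 1 = 1 - c*q*Q^2" "g 2 = 1 - c*q^2*Q^2" "g 3 = 1 - c*q^3*Q^2"
    by (simp_all add: g_def)
  have "L_term q x y c n = Q * A * X 0 * Y 0 * C 0 * inverse (G 0)"
    by (simp add: L_term_def Q_def A_def X_def Y_def C_def G_def divide_inverse)
  also have "\<dots> = K * (Q * (1 - x*Q) * (1 - x*q*Q) * (1 - y*Q) * (1 - y*q*Q)
             * (1 - c*Q) * (1 - c*q*Q) * (1 - c*q^2*Q) * (1 - c*q^3*Q))"
    unfolding X' Y' C' K_def divide_inverse by (simp only: mult_ac)
  finally have t0: "L_term q x y c n = \<dots>" .
  have "L_term q (x * q) (y * q) (c * q ^ 2) n = Q * A * X 1 * Y 1 * C 2 * inverse (G 2)"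
    by (simp add: L_term_def Q_def A_def X_def Y_def C_def G_def divide_inverse power_add
        power2_eq_square mult_ac)
  also have "\<dots> = K * (Q * (1 - x*q*Q) * (1 - y*q*Q) * (1 - c*q^2*Q) * (1 - c*q^3*Q)
             * (1 - c*Q^2) * (1 - c*q*Q^2))"
    unfolding X' Y' C' G' g' K_def divide_inverse by (simp only: mult_ac)
  finally have t1: "L_term q (x * q) (y * q) (c * q ^ 2) n = \<dots>" .
  have "L_term q (x * q ^ 2) (y * q ^ 2) (c * q ^ 4) n
      = Q * A * X 2 * Y 2 * C 4 * inverse (G 4)"
    by (simp add: L_term_def Q_def A_def X_def Y_def C_def G_def divide_inverse power_add
        power2_eq_square mult_ac)
  also have "\<dots> = K * (Q * (1 - c*Q^2) * (1 - c*q*Q^2) * (1 - c*q^2*Q^2) * (1 - c*q^3*Q^2))"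
    unfolding G' g' K_def divide_inverse by (simp only: mult_ac)
  finally have t2: "L_term q (x * q ^ 2) (y * q ^ 2) (c * q ^ 4) n = \<dots>" .
  have "L_antidiff q x y c n = (1 - Q) * A *
      (X 0 * Y 0 * C 2 * (1 - q*c^2*Q^3) * inverse (G 0)
       + c*q^2*Q * X 1 * Y 1 * C 3 * inverse (G 2))"
    by (simp add: L_antidiff_def Q_def A_def X_def Y_def C_def G_def divide_inverse power_add
        power_mult[symmetric] power2_eq_square mult_ac)
  also have "\<dots> = K * ((1 - Q) * (1 - x*q*Q) * (1 - y*q*Q) * (1 - c*q^3*Q) * W Q)"
    unfolding X' Y' C' G' g' K_def W_def divide_inverse by algebra
  finally have T0: "L_antidiff q x y c n = \<dots>" .
  have "L_antidiff q x y c (Suc n) = (1 - q * Q) * qpoch_inf q (q * q ^ Suc n) *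
      (X 1 * Y 1 * C 3 * (1 - q*c^2*(q*Q)^3) * inverse (G 2)
       + c*q^2*(q*Q) * X 2 * Y 2 * C 4 * inverse (G 4))"
    by (simp add: L_antidiff_def Q_def X_def Y_def C_def G_def divide_inverse power_add
        power_mult[symmetric] power_mult_distrib eval_nat_numeral mult_ac)
  also have "\<dots> = K * ((1 - c*Q^2) * (1 - c*q*Q^2) * W (q*Q))"
    unfolding A[symmetric] X' Y' C' G' g' K_def W_def divide_inverse by algebra
  finally have T1: "L_antidiff q x y c (Suc n) = \<dots>" .
  have "x = q * (x / q)" "y = q * (y / q)" "c = (x / q) * (y / q)"
    using q0 xyc by (auto simp: power2_eq_square)
  with antidiff_polynomial_identity[of "x / q" q "y / q" Q] show ?thesis
    unfolding t0 t1 t2 T0 T1 W_def by algebra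
qed

lemma L_antidiff_limit: "L_antidiff q x y c \<longlonglongrightarrow> 1"
proof -
  note lim = qpoch_inf_shift_tendsto[OF q1]
  have pow: "(\<lambda>n. q ^ n) \<longlonglongrightarrow> 0" using q1 by (rule LIMSEQ_power_zero)
  have sub: "(\<lambda>n. q ^ f n) \<longlonglongrightarrow> 0" if "strict_mono f" for f :: "nat \<Rightarrow> nat"
    using filterlim_compose[OF pow filterlim_subseq[OF that]] .
  have "L_antidiff q x y c \<longlonglongrightarrow> (1 - 0) * 1 *
      (1 * 1 * 1 * (1 - q * c ^ 2 * 0) / 1 + c * 0 * 1 * 1 * 1 / 1)"
    unfolding L_antidiff_def[abs_def]
    by (intro tendsto_intros sub pow lim q_nv x_nv y_nv c_nv strict_monoI
        lim[OF q_nv, of "\<lambda>n. n"] lim[OF x_nv, of "\<lambda>n. n"] lim[OF y_nv, of "\<lambda>n. n"]) auto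
  thus ?thesis by simp
qed

lemma L_recursion_base: "L 0 + (x + y) * L 1 + x * y * q * L 2 = 1"
proof -
  have "(\<lambda>n. L_term q x y c n + (x + y) * L_term q (x * q) (y * q) (c * q ^ 2) n
      + x * y * q * L_term q (x * q ^ 2) (y * q ^ 2) (c * q ^ 4) n)
    sums (L 0 + (x + y) * L 1 + x * y * q * L 2)"
    using L_sums[of 0] L_sums[of 1] L_sums[of 2] by (intro sums_add sums_mult) simp_all
  moreover have "(\<lambda>n. L_antidiff q x y c (Suc n) - L_antidiff q x y c n)
      sums (1 - L_antidiff q x y c 0)"
    using L_antidiff_limit by (rule telescope_sums)
  moreover have "L_antidiff q x y c 0 = 0" by (simp add: L_antidiff_def)
  ultimately show ?thesis by (simp add: L_term_telescope sums_iff)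
qed

lemma L_shifted: "L_parameters.L q (x * q ^ N) (y * q ^ N) (c * q ^ (2 * N)) M = L (N + M)"
  unfolding L_def L_parameters.L_def[OF shifted]
  by (simp add: power_add mult.assoc distrib_left)

lemma L_recursion:
  "L N + (x + y) * q ^ N * L (Suc N) + x * y * q ^ (2 * N + 1) * L (Suc (Suc N)) = 1"
  using L_parameters.L_recursion_base[OF shifted, of N, unfolded L_shifted]
  by (simp add: algebra_simps mult_2_right power_add)

text \<open>
  The second-order recursion factors into two first-order ones, and \<open>L N + x q\<^sup>N L (N + 1)\<close>
  solves the one that characterizes the partial theta function.
\<close>

lemma L_theta_base: "L 0 + x * L 1 = partial_theta q y"
proof -
  define \<phi> where "\<phi> N = L N + x * q ^ N * L (Suc N)" for N
  obtain B where B: "\<And>N. norm (L N) \<le> B" using L_bounded by blast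
  have "\<phi> 0 = partial_theta q y"
  proof (rule bounded_solution_eq_partial_theta[OF q1])
    show "\<phi> n + y * q ^ n * \<phi> (Suc n) = 1" for n
      using L_recursion[of n] by (simp add: \<phi>_def algebra_simps mult_2_right power_add)
    show "norm (\<phi> n) \<le> B + norm x * B" for n
    proof -
      have "norm (\<phi> n) \<le> norm (L n) + norm x * norm q ^ n * norm (L (Suc n))"
        unfolding \<phi>_def by (metis norm_mult norm_power norm_triangle_ineq)
      also have "\<dots> \<le> B + norm x * 1 * B"
        using B q1 by (intro add_mono mult_mono mult_nonneg_nonneg power_le_one) auto
      finally show ?thesis by simp
    qed
  qed
  thus ?thesis by (simp add: \<phi>_def)
qed

lemma L_theta_right: "L N + x * q ^ N * L (Suc N) = partial_theta q (y * q ^ N)"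
  using L_parameters.L_theta_base[OF shifted, of N] by (simp add: L_shifted)

lemma L_swapped: "L_parameters.L q y x c N = L N"
proof -
  have "L_term q z w d = L_term q w z d" for z w d
    by (simp add: fun_eq_iff L_term_def mult_ac)
  thus ?thesis unfolding L_def L_parameters.L_def[OF swapped] by metis
qed

lemma L_theta_left: "L N + y * q ^ N * L (Suc N) = partial_theta q (x * q ^ N)"
  using L_parameters.L_theta_right[OF swapped, of N] by (simp add: L_swapped)

section \<open>Adding rows and columns\<close>

lemma theta_column_sum:
  "(\<Sum>i<s. qtau q i * y ^ i * partial_theta q (x * q ^ i)) = L 0 - y ^ s * qtau q s * L s"
proof (induction s)
  case (Suc s)
  thus ?case by (simp add: L_theta_left[symmetric] qtau_Suc algebra_simps)
qed simp

text \<open>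
  Passing from \<open>r\<close> to \<open>r + 1\<close> adds row \<open>r\<close> of the double series without its first \<open>s\<close>
  entries, which the columns already contain.
\<close>

lemma theta_rows_columns:
  "(\<Sum>i<r. qtau q i * x ^ i * partial_theta q (y * q ^ i))
     + (\<Sum>i<s. qtau q i * y ^ i * partial_theta q (x * q ^ i))
     - (\<Sum>i<r. \<Sum>j<s. qtau q (i + j) * x ^ i * y ^ j)
   = L 0 - x ^ r * y ^ s * qtau q (r + s) * L (r + s)"
proof (induction r)
  case 0
  show ?case by (simp add: theta_column_sum)
next
  case (Suc r)
  have "qtau q r * x ^ r * partial_theta q (y * q ^ r)
      = qtau q r * x ^ r * (\<Sum>j<s. qtau q j * (y * q ^ r) ^ j)
        + qtau q r * x ^ r * (qtau q s * (y * q ^ r) ^ s * partial_theta q (y * q ^ r * q ^ s))"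
    using partial_theta_split[OF q1, of "y * q ^ r" s] by (simp add: algebra_simps)
  also have "qtau q r * x ^ r * (\<Sum>j<s. qtau q j * (y * q ^ r) ^ j)
      = (\<Sum>j<s. qtau q (r + j) * x ^ r * y ^ j)"
    by (simp add: sum_distrib_left qtau_add power_mult_distrib power_mult[symmetric] mult_ac)
  also have "qtau q r * x ^ r * (qtau q s * (y * q ^ r) ^ s * partial_theta q (y * q ^ r * q ^ s))
      = x ^ r * y ^ s * qtau q (r + s) * partial_theta q (y * q ^ (r + s))"
    by (simp add: qtau_add power_mult_distrib power_mult[symmetric] power_add mult_ac)
  also have "\<dots> = x ^ r * y ^ s * qtau q (r + s) * L (r + s)
      - x ^ Suc r * y ^ s * qtau q (Suc r + s) * L (Suc r + s)"
    by (simp add: L_theta_right[symmetric] qtau_Suc algebra_simps)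
  finally have row: "qtau q r * x ^ r * partial_theta q (y * q ^ r)
      = (\<Sum>j<s. qtau q (r + j) * x ^ r * y ^ j)
        + (x ^ r * y ^ s * qtau q (r + s) * L (r + s)
           - x ^ Suc r * y ^ s * qtau q (Suc r + s) * L (Suc r + s))" .
  have add_equations: "u + t + v - (d + p) = l - e"
    if "t = p + (m - e)" "u + v - d = l - m" for u v d e l m p t :: complex
    using that by algebra
  show ?case unfolding sum.lessThan_Suc using row Suc.IH by (rule add_equations)
qed

lemma L_series_eq_base: "L_series q x y = L 0"
proof -
  have nz: "qpoch_inf q (z * q ^ n) \<noteq> 0" if "\<And>k::nat. z * q ^ k \<noteq> 1" for z n
    using q1 nonvanishing_shift[OF that] by (rule qpoch_inf_nonzero)
  have nz': "qpoch_inf q q \<noteq> 0" "qpoch_inf q x \<noteq> 0" "qpoch_inf q y \<noteq> 0" "qpoch_inf q c \<noteq> 0"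
    using nz[OF q_nv, of 0] nz[OF x_nv, of 0] nz[OF y_nv, of 0] nz[OF c_nv, of 0] 
    qpoch_inf_nonzero[OF q1 q_nv] by simp_all
  have c: "x * y / q ^ 2 = c" using xyc q0 by simp
  have p: "q powi (int n * 2) = q ^ (n * 2)" for n
    using power_int_of_nat[of q "n * 2"] by simp
  have "qpoch q c (2 * int n) / qpochs q [q, x, y, c] (int n) * q ^ n
      = L_term q x y c n / qpochs_inf q [q, x, y]" for n
    using nz[OF q_nv, of n] nz[OF x_nv, of n] nz[OF y_nv, of n] nz[OF c_nv, of n] nz'
      nz[OF c_nv, of "2 * n"]
    by (simp add: qpoch_def qpochs_def qpochs_inf_def L_term_def p field_simps)
  moreover have "L_term q x y c sums L 0" using L_sums[of 0] by simp
  ultimately have "(\<lambda>n. qpoch q c (2 * int n) / qpochs q [q, x, y, c] (int n) * q ^ n)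
      sums (L 0 / qpochs_inf q [q, x, y])"
    by (simp add: sums_divide)
  hence "(\<Sum>n. qpoch q c (2 * int n) / qpochs q [q, x, y, c] (int n) * q ^ n)
      = L 0 / qpochs_inf q [q, x, y]"
    by (rule sums_unique[symmetric])
  with nz' show ?thesis unfolding L_series_def c by (simp add: qpochs_inf_def)
qed

lemma L_series_eq: "L_series q (x * q ^ N) (y * q ^ N) = L N"
  using L_parameters.L_series_eq_base[OF shifted, of N] by (simp add: L_shifted)

end

theorem theorem4p2:
  fixes q a b :: complex and r s :: nat
  assumes "0 < norm q" and "norm q < 1"
    and "\<And>k::nat. a * q ^ k \<noteq> 1"
    and "\<And>k::nat. b * q ^ k \<noteq> 1"
    and "\<And>k::nat. a * b / q ^ 2 * q ^ k \<noteq> 1"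
  shows "(\<Sum>i<r. qtau q i * a ^ i * partial_theta q (b * q ^ i))
       + (\<Sum>i<s. qtau q i * b ^ i * partial_theta q (a * q ^ i))
       - (\<Sum>i<r. \<Sum>j<s. qtau q (i + j) * a ^ i * b ^ j)
       = L_series q a b
       - a ^ r * b ^ s * qtau q (r + s) * L_series q (a * q ^ (r + s)) (b * q ^ (r + s))"
proof -
  interpret L_parameters q a b "a * b / q ^ 2"
    by standard (use assms in auto)
  show ?thesis
    using theta_rows_columns[of r s] L_series_eq[of "r + s"] L_series_eq[of 0] by simp
qed

end
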